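(* Let $k\ge 2$ and $\lambda\ge \frac{1}{3k}$, and consider the common-chunk-protocol Markov process. Let $C=108\,e\,k^3$ and define on the state space \[ L(\mathbf{x}) \;=\; C\sum_{i=1}^k \bar S_i \;+\; \sum_{i=1}^k \frac{S}{e^{S_i}} \;+\; \frac{S}{e^{S_0}} . \] Then there exists $\epsilon>0$ such that $\Delta L(\mathbf{x})<-\epsilon$ for every state $\mathbf{x}$ with \[ S \;>\; 4Ck\,\exp\!\Big(3C\lambda k^2 e^{6\lambda k^4}\Big). \]
   Context: Model: Fix an integer $k\ge 2$ (number of chunks of a file) and $\lambda>0$. There is always exactly one seed holding all $k$ chunks. Non-seed peers arrive according to a Poisson process of rate $\lambda$, each arriving with no chunks; each non-seed peer holds a subset (its profile) of $\{1,\dots,k\}$ and leaves the system immediately once it holds all $k$ chunks. The state $\mathbf{x}$ of the continuous-time Markov process is the number of non-seed peers with each profile. $S$ denotes the total number of peers present, including the seed. Each non-seed peer has an independent rate-1 Poisson clock; at each tick it draws a sample of peers independently and uniformly at random with replacement from the current $S$ peers (seed and itself included) and may instantaneously download at most one chunk that it lacks and that is held by some sampled peer (such a chunk is a "match"). Counting draws with multiplicity, a chunk is "rare" in a sample of 3 draws if exactly one of the 3 draws holds it. Common chunk protocol: (i) a peer with no chunks draws 3 peers and downloads a chunk chosen uniformly among the rare matches, if there is any, otherwise nothing; (ii) a peer holding at least 1 and at most $k-2$ chunks draws 1 peer and downloads a uniformly chosen match, if any, otherwise nothing; (iii) a peer holding exactly $k-1$ chunks draws 3 peers and downloads its missing chunk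 only if that chunk is held by some draw and every chunk it holds is held by at least 2 of the 3 draws; otherwise nothing. Notation: $S_i$ ($1\le i\le k$) is the number of peers, including the seed, holding chunk $i$; $S_0$ is the number of peers holding no chunks; $\bar S_i=S-S_i$. For a function $f$ on the state space, with $q(\mathbf{x},\mathbf{x}')$ the transition rates of the Markov process, the drift is $\Delta f(\mathbf{x})=\sum_{\mathbf{x}'\neq\mathbf{x}} q(\mathbf{x},\mathbf{x}')\,(f(\mathbf{x}')-f(\mathbf{x}))$. *)

theory Defs
  imports Complex_Main
begin

text \<open>Chunks are 1..k. A state assigns to every profile (a subset of {1..k}) the number of
non-seed peers holding exactly that profile; only proper subsets of {1..k} may be nonzero
(peers with all chunks leave immediately).\<close>

type_synonym state = "nat set \<Rightarrow> nat"

definition chunks :: "nat \<Rightarrow> nat set" where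
  "chunks k = {1..k}"

definition profiles :: "nat \<Rightarrow> nat set set" where
  "profiles k = {A. A \<subset> chunks k}"

definition valid_state :: "nat \<Rightarrow> state \<Rightarrow> bool" where
  "valid_state k x \<longleftrightarrow> (\<forall>A. x A \<noteq> 0 \<longrightarrow> A \<in> profiles k)"

text \<open>Total number of peers, including the seed.\<close>
definition S :: "nat \<Rightarrow> state \<Rightarrow> nat" where
  "S k x = 1 + (\<Sum>A\<in>profiles k. x A)"

text \<open>Number of peers (including the seed) holding chunk i.\<close>
definition Si :: "nat \<Rightarrow> state \<Rightarrow> nat \<Rightarrow> nat" where
  "Si k x i = 1 + (\<Sum>A\<in>{A\<in>profiles k. i \<in> A}. x A)"

definition S0 :: "state \<Rightarrow> nat" where
  "S0 x = x {}"

definition Sbar :: "nat \<Rightarrow> state \<Rightarrow> nat \<Rightarrow> nat" where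
  "Sbar k x i = S k x - Si k x i"

text \<open>Number of peers (seed included) with profile B, for any B \<subseteq> {1..k}.\<close>
definition npeers :: "nat \<Rightarrow> state \<Rightarrow> nat set \<Rightarrow> nat" where
  "npeers k x B = (if B = chunks k then 1 else x B)"

text \<open>Probability that a single uniform draw (with replacement) from the S peers has profile B.\<close>
definition w :: "nat \<Rightarrow> state \<Rightarrow> nat set \<Rightarrow> real" where
  "w k x B = real (npeers k x B) / real (S k x)"

definition cnt3 :: "nat \<Rightarrow> nat set \<Rightarrow> nat set \<Rightarrow> nat set \<Rightarrow> nat" where
  "cnt3 i B1 B2 B3 = (if i \<in> B1 then 1 else 0) + (if i \<in> B2 then 1 else 0) + (if i \<in> B3 then 1 else 0)"

definition rare3 :: "nat \<Rightarrow> nat set \<Rightarrow> nat set \<Rightarrow> nat set \<Rightarrow> nat set" where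
  "rare3 k B1 B2 B3 = {i \<in> chunks k. cnt3 i B1 B2 B3 = 1}"

text \<open>Probability that, at a clock tick, a peer with profile A downloads chunk c
(common chunk protocol).\<close>
definition pdl :: "nat \<Rightarrow> state \<Rightarrow> nat set \<Rightarrow> nat \<Rightarrow> real" where
  "pdl k x A c =
    (if A = {} then
       (\<Sum>B1\<in>Pow (chunks k). \<Sum>B2\<in>Pow (chunks k). \<Sum>B3\<in>Pow (chunks k).
          w k x B1 * w k x B2 * w k x B3 *
          (if c \<in> rare3 k B1 B2 B3 then 1 / real (card (rare3 k B1 B2 B3)) else 0))
     else if card A \<le> k - 2 then
       (\<Sum>B\<in>Pow (chunks k). w k x B *
          (if c \<in> B - A then 1 / real (card (B - A)) else 0))
     else
       (\<Sum>B1\<in>Pow (chunks k). \<Sum>B2\<in>Pow (chunks k). \<Sum>B3\<in>Pow (chunks k).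
          w k x B1 * w k x B2 * w k x B3 *
          (if c \<in> B1 \<union> B2 \<union> B3 \<and> (\<forall>i\<in>A. 2 \<le> cnt3 i B1 B2 B3) then 1 else 0)))"

definition arrival :: "state \<Rightarrow> state" where
  "arrival x = x({} := x {} + 1)"

definition move :: "nat \<Rightarrow> state \<Rightarrow> nat set \<Rightarrow> nat \<Rightarrow> state" where
  "move k x A c =
    (let y = x(A := x A - 1); B = insert c A in
     if B = chunks k then y else y(B := y B + 1))"

definition Next :: "nat \<Rightarrow> state \<Rightarrow> state set" where
  "Next k x = insert (arrival x)
     {move k x A c | A c. A \<in> profiles k \<and> c \<in> chunks k - A \<and> 0 < x A}"

text \<open>Transition rate from x to y (y \<noteq> x).\<close>
definition q :: "nat \<Rightarrow> real \<Rightarrow> state \<Rightarrow> state \<Rightarrow> real" where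
  "q k lam x y =
     (if y = arrival x then lam else 0) +
     (\<Sum>A\<in>profiles k. \<Sum>c\<in>chunks k - A.
        real (x A) * pdl k x A c * (if y = move k x A c then 1 else 0))"

definition drift :: "nat \<Rightarrow> real \<Rightarrow> (state \<Rightarrow> real) \<Rightarrow> state \<Rightarrow> real" where
  "drift k lam f x = (\<Sum>y\<in>Next k x - {x}. q k lam x y * (f y - f x))"

definition Lyap :: "nat \<Rightarrow> real \<Rightarrow> state \<Rightarrow> real" where
  "Lyap k C x =
     C * (\<Sum>i\<in>chunks k. real (Sbar k x i))
     + (\<Sum>i\<in>chunks k. real (S k x) / exp (real (Si k x i)))
     + real (S k x) / exp (real (S0 x))"

end

theory Submission
  imports Defs
begin

text \<open>
  Write \<open>p\<^sub>c = S\<^sub>c / S\<close>, and split the fraction \<open>1 - p\<^sub>c\<close> of peers lacking \<open>c\<close> as \<open>e + m\<^sub>c + a\<^sub>c\<close>: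
  empty peers, peers with 1 to \<open>k - 2\<close> chunks, and peers lacking only \<open>c\<close> (\<open>pop\<close>, \<open>empties\<close>,
  \<open>mid_lacking\<close>, \<open>only_lacking\<close> below). Each download
  lowers the first term of \<open>L\<close> by \<open>C\<close>, and the total download rate \<open>T\<close> (\<open>dl_rate\<close>) satisfies
  \<open>T / S \<ge> p\<^sub>c (3 e (1 - p\<^sub>c)\<^sup>2 + m\<^sub>c + 3 a\<^sub>c\<^sup>3)\<close> for every \<open>c\<close>.

  Two effects raise \<open>L\<close>. A departing peer lowers \<open>S\<^sub>i\<close> only if two draws hold \<open>i\<close>, which costs at most
  a multiple of \<open>S\<^sub>i\<^sup>3 exp (- S\<^sub>i) / S\<close>. A download by an empty peer lowers \<open>S\<^sub>0\<close>; this costs a bounded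
  amount plus a multiple of \<open>S \<Sum>\<^sub>c p\<^sub>c (m\<^sub>c + a\<^sub>c)\<^sup>2\<close>, and the latter is \<open>O(k\<^sup>3 T)\<close>: unless \<open>e\<close> is large, some
  chunk \<open>j\<close> has \<open>m\<^sub>j\<close> or \<open>a\<^sub>j\<close> of order at least \<open>1 / k\<close>, so that \<open>p\<^sub>j = O(k\<^sup>3 T / S)\<close>, while \<open>p\<^sub>j\<close> dominates
  \<open>a\<^sub>c\<close> summed over \<open>c \<noteq> j\<close>. This is what the size of \<open>C\<close> pays for.

  It remains to beat the arrival term \<open>C \<lambda> k\<close>. If \<open>S\<^sub>0\<close> is at most \<open>3 C \<lambda> k\<^sup>2 exp (6 \<lambda> k\<^sup>4)\<close>, arrivals
  shrink \<open>S / exp S\<^sub>0\<close> fast enough, as \<open>S\<close> is huge. Otherwise let \<open>c\<close> be a chunk lacked by a fraction of about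
  \<open>1 / k\<close> of the peers: if \<open>S\<^sub>c \<le> 6 \<lambda> k\<^sup>4\<close>, the many empty peers downloading \<open>c\<close> shrink
  \<open>S / exp S\<^sub>c\<close>, and if not, \<open>T \<ge> 3/8 S\<^sub>c (1 - p\<^sub>c)\<^sup>3\<close> is large.
\<close>

subsection \<open>Transitions and the Lyapunov function\<close>

lemma finite_chunks [simp]: "finite (chunks k)"
  and card_chunks [simp]: "card (chunks k) = k"
  by (simp_all add: chunks_def)

lemma Pow_chunks_eq: "Pow (chunks k) = insert (chunks k) (profiles k)"
  by (auto simp: profiles_def)

lemma finite_profiles [simp]: "finite (profiles k)"
  by (rule finite_subset[of _ "Pow (chunks k)"]) (auto simp: profiles_def)

lemma chunks_notin_profiles [simp]: "chunks k \<notin> profiles k"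
  by (simp add: profiles_def)

lemma finite_profile: "A \<in> profiles k \<Longrightarrow> finite A"
  by (auto simp: profiles_def intro: finite_subset[OF _ finite_chunks])

lemma card_profile_less: "A \<in> profiles k \<Longrightarrow> card A < k"
  using psubset_card_mono[OF finite_chunks, of A k] by (simp add: profiles_def)

lemma empty_in_profiles: "0 < k \<Longrightarrow> {} \<in> profiles k"
  by (auto simp: profiles_def chunks_def)

lemma S_pos: "0 < S k x"
  by (simp add: S_def)

lemma Si_pos: "1 \<le> Si k x i"
  by (simp add: Si_def)

lemma Si_le_S: "Si k x i \<le> S k x"
  unfolding Si_def S_def by (intro add_mono order_refl sum_mono2) auto

lemma drift_eq:
  "drift k lam f x = lam * (f (arrival x) - f x)
     + (\<Sum>A\<in>profiles k. \<Sum>c\<in>chunks k - A. real (x A) * pdl k x A c * (f (move k x A c) - f x))"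
proof -
  have "{move k x A c |A c. A \<in> profiles k \<and> c \<in> chunks k - A \<and> 0 < x A}
      \<subseteq> (\<lambda>(A, c). move k x A c) ` (profiles k \<times> chunks k)"
    by auto
  then have fin: "finite (Next k x)"
    unfolding Next_def using finite_subset by fastforce
  have "drift k lam f x = (\<Sum>y\<in>Next k x. q k lam x y * (f y - f x))"
    unfolding drift_def by (rule sum.mono_neutral_left) (auto simp: fin)
  also have "\<dots> = (\<Sum>y\<in>Next k x. (if y = arrival x then lam * (f y - f x) else 0))
     + (\<Sum>y\<in>Next k x. \<Sum>A\<in>profiles k. \<Sum>c\<in>chunks k - A.
        if y = move k x A c then real (x A) * pdl k x A c * (f y - f x) else 0)"
    unfolding q_def sum.distrib[symmetric]
    by (intro sum.cong refl) (auto simp: distrib_right sum_distrib_right intro!: sum.cong)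
  also have "(\<Sum>y\<in>Next k x. (if y = arrival x then lam * (f y - f x) else 0))
      = lam * (f (arrival x) - f x)"
    using fin by (simp add: Next_def)
  also have "(\<Sum>y\<in>Next k x. \<Sum>A\<in>profiles k. \<Sum>c\<in>chunks k - A.
        if y = move k x A c then real (x A) * pdl k x A c * (f y - f x) else 0)
     = (\<Sum>A\<in>profiles k. \<Sum>c\<in>chunks k - A. \<Sum>y\<in>Next k x.
        if y = move k x A c then real (x A) * pdl k x A c * (f y - f x) else 0)"
    by (subst sum.swap) (intro sum.cong refl, rule sum.swap)
  also have "\<dots> = (\<Sum>A\<in>profiles k. \<Sum>c\<in>chunks k - A.
      real (x A) * pdl k x A c * (f (move k x A c) - f x))"
  proof (intro sum.cong refl)
    fix A c assume "A \<in> profiles k" "c \<in> chunks k - A"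
    then have "move k x A c \<in> Next k x \<or> x A = 0"
      by (auto simp: Next_def)
    then show "(\<Sum>y\<in>Next k x. if y = move k x A c
          then real (x A) * pdl k x A c * (f y - f x) else 0)
        = real (x A) * pdl k x A c * (f (move k x A c) - f x)"
      using fin by auto
  qed
  finally show ?thesis .
qed

lemma sum_move:
  assumes "0 < x A" "c \<notin> A" "P \<subseteq> profiles k"
  shows "real (\<Sum>D\<in>P. move k x A c D)
     = real (\<Sum>D\<in>P. x D) - of_bool (A \<in> P) + of_bool (insert c A \<in> P)"
proof -
  have finP: "finite P"
    using assms(3) finite_profiles finite_subset by blast
  have neq: "insert c A \<noteq> A" using assms(2) by auto
  have "real (move k x A c D) = real (x D) - of_bool (D = A) + of_bool (D = insert c A)"
    if "D \<in> P" for D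
    using assms that neq by (auto simp: move_def Let_def)
  then have "real (\<Sum>D\<in>P. move k x A c D)
      = (\<Sum>D\<in>P. real (x D) - of_bool (D = A) + of_bool (D = insert c A))"
    by simp
  also have "\<dots> = real (\<Sum>D\<in>P. x D) - (\<Sum>D\<in>P. of_bool (D = A))
      + (\<Sum>D\<in>P. of_bool (D = insert c A))"
    by (simp add: sum.distrib sum_subtractf)
  finally show ?thesis
    using finP by (simp add: of_bool_def)
qed

lemma
  assumes "0 < x A" "A \<in> profiles k" "c \<in> chunks k - A"
  shows S_move: "real (S k (move k x A c)) = real (S k x) - of_bool (insert c A = chunks k)"
    and Si_move: "real (Si k (move k x A c) i) = real (Si k x i)
      + (if insert c A = chunks k then - of_bool (i \<in> A) else of_bool (i = c))"
    and S0_move: "real (S0 (move k x A c)) = real (S0 x) - of_bool (A = {})"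
proof -
  have sub: "insert c A \<subseteq> chunks k"
    using assms by (auto simp: profiles_def)
  have mem: "insert c A \<in> profiles k \<longleftrightarrow> insert c A \<noteq> chunks k"
    using sub by (simp add: profiles_def psubset_eq)
  have cA: "c \<notin> A" using assms(3) by simp
  show "real (S k (move k x A c)) = real (S k x) - of_bool (insert c A = chunks k)"
    using sum_move[where x = x, OF assms(1) cA, of "profiles k" k] assms(2) mem
    by (simp add: S_def)
  show "real (Si k (move k x A c) i) = real (Si k x i)
      + (if insert c A = chunks k then - of_bool (i \<in> A) else of_bool (i = c))"
    using sum_move[where x = x, OF assms(1) cA, of "{D \<in> profiles k. i \<in> D}" k] assms(2) mem cA
    by (cases "i = c"; cases "i \<in> A") (simp_all add: Si_def)
  show "real (S0 (move k x A c)) = real (S0 x) - of_bool (A = {})"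
    using assms by (auto simp: S0_def move_def Let_def)
qed

lemma
  assumes "0 < k"
  shows S_arrival: "S k (arrival x) = S k x + 1"
    and Si_arrival: "Si k (arrival x) i = Si k x i"
    and S0_arrival: "S0 (arrival x) = S0 x + 1"
proof -
  have "(\<Sum>D\<in>profiles k. arrival x D) = (\<Sum>D\<in>profiles k. x D + (if D = {} then 1 else 0))"
    by (intro sum.cong) (auto simp: arrival_def)
  then show "S k (arrival x) = S k x + 1"
    using empty_in_profiles[OF assms] by (simp add: S_def sum.distrib)
  show "Si k (arrival x) i = Si k x i"
    by (auto simp: Si_def arrival_def intro!: sum.cong)
  show "S0 (arrival x) = S0 x + 1"
    by (simp add: S0_def arrival_def)
qed

lemma Lyap_alt:
  "Lyap k C x = C * (\<Sum>i\<in>chunks k. real (S k x) - real (Si k x i))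
     + (\<Sum>i\<in>chunks k. real (S k x) * exp (- real (Si k x i)))
     + real (S k x) * exp (- real (S0 x))"
  by (simp add: Lyap_def Sbar_def of_nat_diff[OF Si_le_S] exp_minus divide_inverse)

lemma Lyap_arrival_le:
  assumes "0 < k"
  shows "Lyap k C (arrival x) - Lyap k C x
    \<le> C * real k + real k + 1 - (1 - exp (-1)) * (real (S k x) * exp (- real (S0 x)))"
proof -
  let ?s = "real (S k x)" and ?n = "real (S0 x)"
  have ex: "exp (- 1 - ?n) = exp (-1) * exp (- ?n)"
    by (simp add: exp_diff exp_minus field_simps)
  have "Lyap k C (arrival x) - Lyap k C x = C * real k + (\<Sum>i\<in>chunks k. exp (- real (Si k x i)))
      + ((?s + 1) * exp (- 1 - ?n) - ?s * exp (- ?n))"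
    by (simp add: Lyap_alt S_arrival[OF assms] Si_arrival[OF assms] S0_arrival[OF assms]
        sum.distrib sum_subtractf algebra_simps)
  also have "(\<Sum>i\<in>chunks k. exp (- real (Si k x i))) \<le> real k"
    using sum_bounded_above[of "chunks k" "\<lambda>i. exp (- real (Si k x i))" 1] by simp
  also have "(?s + 1) * exp (- 1 - ?n) - ?s * exp (- ?n)
      = exp (- 1 - ?n) - (1 - exp (-1)) * (?s * exp (- ?n))"
    unfolding ex by (simp add: algebra_simps)
  also have "exp (- 1 - ?n) \<le> 1" by simp
  finally show ?thesis by simp
qed

lemma Lyap_move_le:
  assumes "2 \<le> k" "0 < x A" "A \<in> profiles k" "c \<in> chunks k - A"
  shows "Lyap k C (move k x A c) - Lyap k C x
    \<le> - C + (if A = {} then (exp 1 - 1) * (real (S k x) * exp (- real (S0 x)))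
                 - (1 - exp (-1)) * (real (S k x) * exp (- real (Si k x c))) else 0)
         + (if card A = k - 1 then \<Sum>i\<in>A. (exp 1 - 1) * (real (S k x) * exp (- real (Si k x i)))
            else 0)"
proof -
  let ?s = "real (S k x)" and ?n = "real (S0 x)" and ?y = "move k x A c"
  let ?r = "\<lambda>i. real (Si k x i)"
  have sub: "A \<subseteq> chunks k" and finA: "finite A"
    using assms(3) finite_profile by (auto simp: profiles_def)
  have cardA: "card (insert c A) = card A + 1"
    using assms(4) finA by simp
  have full_iff: "insert c A = chunks k \<longleftrightarrow> card A = k - 1"
  proof
    assume "insert c A = chunks k"
    then show "card A = k - 1" using cardA by simp
  next
    assume "card A = k - 1"
    then have "card (insert c A) = card (chunks k)" using cardA assms(1) by simp
    then show "insert c A = chunks k"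
      using assms(4) sub by (intro card_subset_eq) auto
  qed
  note mv = S_move[where x = x, OF assms(2-4)] Si_move[where x = x, OF assms(2-4)]
    S0_move[where x = x, OF assms(2-4)]
  show ?thesis
  proof (cases "card A = k - 1")
    case True
    then have full: "insert c A = chunks k" using full_iff by simp
    have ne: "A \<noteq> {}" using True assms(1) by auto
    have "(\<Sum>i\<in>chunks k. real (S k ?y) - real (Si k ?y i))
        = (\<Sum>i\<in>chunks k. (?s - ?r i) - of_bool (i = c))"
      using full assms(4) by (intro sum.cong) (auto simp: mv)
    also have "\<dots> = (\<Sum>i\<in>chunks k. ?s - ?r i) - 1"
      using assms(4) by (simp add: sum_subtractf of_bool_def)
    finally have 1: "(\<Sum>i\<in>chunks k. real (S k ?y) - real (Si k ?y i))
        = (\<Sum>i\<in>chunks k. ?s - ?r i) - 1" .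
    have "(\<Sum>i\<in>chunks k. real (S k ?y) * exp (- real (Si k ?y i)))
        \<le> (\<Sum>i\<in>chunks k. ?s * exp (- ?r i)
            + (if i \<in> A then (exp 1 - 1) * (?s * exp (- ?r i)) else 0))"
    proof (intro sum_mono)
      fix i assume "i \<in> chunks k"
      have "exp (1 - ?r i) = exp 1 * exp (- ?r i)"
        by (simp add: exp_diff exp_minus field_simps)
      then show "real (S k ?y) * exp (- real (Si k ?y i))
          \<le> ?s * exp (- ?r i) + (if i \<in> A then (exp 1 - 1) * (?s * exp (- ?r i)) else 0)"
        using full by (simp add: mv algebra_simps)
    qed
    also have "\<dots> = (\<Sum>i\<in>chunks k. ?s * exp (- ?r i))
        + (\<Sum>i\<in>A. (exp 1 - 1) * (?s * exp (- ?r i)))"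
      using sub by (simp add: sum.distrib sum.If_cases Int_absorb1)
    finally have 2: "(\<Sum>i\<in>chunks k. real (S k ?y) * exp (- real (Si k ?y i)))
        \<le> (\<Sum>i\<in>chunks k. ?s * exp (- ?r i)) + (\<Sum>i\<in>A. (exp 1 - 1) * (?s * exp (- ?r i)))" .
    have 3: "real (S k ?y) * exp (- real (S0 ?y)) \<le> ?s * exp (- ?n)"
      using ne full by (simp add: mv)
    show ?thesis
      unfolding Lyap_alt 1 using 2 3 True ne by (simp add: algebra_simps)
  next
    case False
    then have nfull: "insert c A \<noteq> chunks k" using full_iff by simp
    have "(\<Sum>i\<in>chunks k. real (S k ?y) - real (Si k ?y i))
        = (\<Sum>i\<in>chunks k. (?s - ?r i) - of_bool (i = c))"
      using nfull by (intro sum.cong) (auto simp: mv)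
    also have "\<dots> = (\<Sum>i\<in>chunks k. ?s - ?r i) - 1"
      using assms(4) by (simp add: sum_subtractf of_bool_def)
    finally have 1: "(\<Sum>i\<in>chunks k. real (S k ?y) - real (Si k ?y i))
        = (\<Sum>i\<in>chunks k. ?s - ?r i) - 1" .
    have "(\<Sum>i\<in>chunks k. real (S k ?y) * exp (- real (Si k ?y i)))
        = (\<Sum>i\<in>chunks k. ?s * exp (- ?r i)
            - (if i = c then (1 - exp (-1)) * (?s * exp (- ?r i)) else 0))"
    proof (intro sum.cong refl)
      fix i assume "i \<in> chunks k"
      have "exp (- 1 - ?r i) = exp (- 1) * exp (- ?r i)"
        by (simp add: exp_diff exp_minus field_simps)
      then show "real (S k ?y) * exp (- real (Si k ?y i))
          = ?s * exp (- ?r i) - (if i = c then (1 - exp (-1)) * (?s * exp (- ?r i)) else 0)"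
        using nfull by (cases "i = c") (simp_all add: mv algebra_simps)
    qed
    also have "\<dots> = (\<Sum>i\<in>chunks k. ?s * exp (- ?r i)) - (1 - exp (-1)) * (?s * exp (- ?r c))"
      using assms(4) by (simp add: sum_subtractf)
    finally have 2: "(\<Sum>i\<in>chunks k. real (S k ?y) * exp (- real (Si k ?y i)))
        = (\<Sum>i\<in>chunks k. ?s * exp (- ?r i)) - (1 - exp (-1)) * (?s * exp (- ?r c))" .
    have "exp (1 - ?n) = exp 1 * exp (- ?n)"
      by (simp add: exp_diff exp_minus field_simps)
    then have 3: "real (S k ?y) * exp (- real (S0 ?y)) = ?s * exp (- ?n)
        + (if A = {} then (exp 1 - 1) * (?s * exp (- ?n)) else 0)"
      using nfull by (simp add: mv algebra_simps)
    have "0 \<le> (1 - exp (-1)) * (?s * exp (- ?r c))" by simp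
    then show ?thesis
      unfolding Lyap_alt 1 2 3 using False by (simp add: algebra_simps)
  qed
qed

subsection \<open>Download probabilities\<close>

definition expect :: "nat \<Rightarrow> state \<Rightarrow> (nat set \<Rightarrow> real) \<Rightarrow> real" where
  "expect k x f = (\<Sum>B\<in>Pow (chunks k). w k x B * f B)"

definition expect3 :: "nat \<Rightarrow> state \<Rightarrow> (nat set \<Rightarrow> nat set \<Rightarrow> nat set \<Rightarrow> real) \<Rightarrow> real" where
  "expect3 k x f = (\<Sum>B1\<in>Pow (chunks k). \<Sum>B2\<in>Pow (chunks k). \<Sum>B3\<in>Pow (chunks k).
     w k x B1 * w k x B2 * w k x B3 * f B1 B2 B3)"

definition pop :: "nat \<Rightarrow> state \<Rightarrow> nat \<Rightarrow> real" where
  "pop k x i = real (Si k x i) / real (S k x)"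

lemma w_nonneg: "0 \<le> w k x B"
  by (simp add: w_def)

lemma expect_mono:
  assumes "\<And>B. B \<subseteq> chunks k \<Longrightarrow> f B \<le> g B"
  shows "expect k x f \<le> expect k x g"
  unfolding expect_def using assms by (intro sum_mono mult_left_mono w_nonneg) auto

lemma expect3_mono:
  assumes "\<And>B1 B2 B3. \<lbrakk>B1 \<subseteq> chunks k; B2 \<subseteq> chunks k; B3 \<subseteq> chunks k\<rbrakk> \<Longrightarrow> f B1 B2 B3 \<le> g B1 B2 B3"
  shows "expect3 k x f \<le> expect3 k x g"
  unfolding expect3_def using assms
  by (intro sum_mono mult_left_mono mult_nonneg_nonneg w_nonneg) auto

lemma expect3_add:
  "expect3 k x (\<lambda>B1 B2 B3. f B1 B2 B3 + g B1 B2 B3) = expect3 k x f + expect3 k x g"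
  by (simp add: expect3_def distrib_left sum.distrib)

lemma expect3_prod:
  "expect3 k x (\<lambda>B1 B2 B3. f B1 * g B2 * h B3) = expect k x f * expect k x g * expect k x h"
proof -
  have "expect3 k x (\<lambda>B1 B2 B3. f B1 * g B2 * h B3)
      = (\<Sum>B1\<in>Pow (chunks k). w k x B1 * f B1 * (\<Sum>B2\<in>Pow (chunks k). w k x B2 * g B2 *
          (\<Sum>B3\<in>Pow (chunks k). w k x B3 * h B3)))"
    unfolding expect3_def sum_distrib_left by (intro sum.cong refl) (simp add: mult_ac)
  also have "\<dots> = expect k x f * (expect k x g * expect k x h)"
    unfolding expect_def by (simp only: sum_distrib_right[symmetric])
  finally show ?thesis by (simp add: mult.assoc)
qed

lemma expect3_cmult: "expect3 k x (\<lambda>B1 B2 B3. a * f B1 B2 B3) = a * expect3 k x f"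
  by (simp add: expect3_def sum_distrib_left mult_ac)

lemma sum_expect: "(\<Sum>c\<in>I. expect k x (f c)) = expect k x (\<lambda>B. \<Sum>c\<in>I. f c B)"
  unfolding expect_def sum_distrib_left by (rule sum.swap)

lemma sum_expect3:
  "(\<Sum>c\<in>I. expect3 k x (f c)) = expect3 k x (\<lambda>B1 B2 B3. \<Sum>c\<in>I. f c B1 B2 B3)"
proof (induction I rule: infinite_finite_induct)
  case (insert c I)
  then show ?case by (simp add: expect3_add)
qed (simp_all add: expect3_def)

lemma sum_npeers: "(\<Sum>B\<in>profiles k. real (npeers k x B) * f B) = (\<Sum>B\<in>profiles k. real (x B) * f B)"
  by (intro sum.cong refl) (auto simp: npeers_def)

lemma expect_alt:
  "expect k x f = (f (chunks k) + (\<Sum>B\<in>profiles k. real (x B) * f B)) / real (S k x)"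
proof -
  have "expect k x f = (\<Sum>B\<in>Pow (chunks k). real (npeers k x B) * f B) / real (S k x)"
    by (simp add: expect_def w_def sum_divide_distrib)
  also have "(\<Sum>B\<in>Pow (chunks k). real (npeers k x B) * f B)
      = f (chunks k) + (\<Sum>B\<in>profiles k. real (x B) * f B)"
    unfolding Pow_chunks_eq by (simp add: sum_npeers) (simp add: npeers_def)
  finally show ?thesis .
qed

lemma expect_mem: "i \<in> chunks k \<Longrightarrow> expect k x (\<lambda>B. of_bool (i \<in> B)) = pop k x i"
  by (simp add: expect_alt pop_def Si_def sum.inter_filter of_bool_def if_distrib cong: if_cong)

lemma expect_const: "expect k x (\<lambda>B. a) = a"
proof -
  have "a + (\<Sum>B\<in>profiles k. real (x B) * a) = a * real (S k x)"
    by (simp add: S_def sum_distrib_left distrib_left mult.commute)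
  then show ?thesis
    using S_pos[of k x] by (simp add: expect_alt)
qed

lemma expect_not_mem: "i \<in> chunks k \<Longrightarrow> expect k x (\<lambda>B. of_bool (i \<notin> B)) = 1 - pop k x i"
proof -
  assume i: "i \<in> chunks k"
  have "expect k x (\<lambda>B. of_bool (i \<notin> B)) + expect k x (\<lambda>B. of_bool (i \<in> B)) = expect k x (\<lambda>B. 1)"
    unfolding expect_def sum.distrib[symmetric] by (intro sum.cong) auto
  then show ?thesis by (simp add: expect_mem[OF i] expect_const)
qed

lemma expect_eq: "A \<subseteq> chunks k \<Longrightarrow> expect k x (\<lambda>B. of_bool (B = A)) = w k x A"
  by (simp add: expect_def of_bool_def if_distrib cong: if_cong)

lemma expect3_rare:
  assumes "c \<in> chunks k"
  shows "expect3 k x (\<lambda>B1 B2 B3. of_bool (c \<in> rare3 k B1 B2 B3)) = 3 * pop k x c * (1 - pop k x c)\<^sup>2"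
proof -
  have "of_bool (c \<in> rare3 k B1 B2 B3) =
      of_bool (c \<in> B1) * of_bool (c \<notin> B2) * of_bool (c \<notin> B3)
      + of_bool (c \<notin> B1) * of_bool (c \<in> B2) * of_bool (c \<notin> B3)
      + (of_bool (c \<notin> B1) * of_bool (c \<notin> B2) * of_bool (c \<in> B3) :: real)" for B1 B2 B3
    using assms by (simp add: rare3_def cnt3_def)
  then show ?thesis
    by (simp only: expect3_add expect3_prod expect_mem[OF assms] expect_not_mem[OF assms])
      (simp add: power2_eq_square algebra_simps)
qed

lemma pdl_empty: "pdl k x {} c = expect3 k x (\<lambda>B1 B2 B3.
    if c \<in> rare3 k B1 B2 B3 then 1 / real (card (rare3 k B1 B2 B3)) else 0)"
  by (simp add: pdl_def expect3_def)

lemma finite_rare3 [simp]: "finite (rare3 k B1 B2 B3)"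
  by (simp add: rare3_def)

lemma card_rare3_le: "card (rare3 k B1 B2 B3) \<le> k"
  using card_mono[OF finite_chunks, of "rare3 k B1 B2 B3" k] by (auto simp: rare3_def)

lemma pdl_empty_le:
  assumes "c \<in> chunks k"
  shows "pdl k x {} c \<le> 3 * pop k x c * (1 - pop k x c)\<^sup>2"
  unfolding pdl_empty expect3_rare[OF assms, symmetric]
proof (rule expect3_mono)
  fix B1 B2 B3
  show "(if c \<in> rare3 k B1 B2 B3 then 1 / real (card (rare3 k B1 B2 B3)) else 0)
      \<le> of_bool (c \<in> rare3 k B1 B2 B3)"
    by (cases "card (rare3 k B1 B2 B3)") auto
qed

lemma pdl_empty_ge:
  assumes "c \<in> chunks k"
  shows "3 * pop k x c * (1 - pop k x c)\<^sup>2 / real k \<le> pdl k x {} c"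
proof -
  have "expect3 k x (\<lambda>B1 B2 B3. 1 / real k * of_bool (c \<in> rare3 k B1 B2 B3)) \<le> pdl k x {} c"
    unfolding pdl_empty
  proof (rule expect3_mono)
    fix B1 B2 B3
    have "0 < card (rare3 k B1 B2 B3)" if "c \<in> rare3 k B1 B2 B3"
      using that by (auto simp: card_gt_0_iff)
    then show "1 / real k * of_bool (c \<in> rare3 k B1 B2 B3)
        \<le> (if c \<in> rare3 k B1 B2 B3 then 1 / real (card (rare3 k B1 B2 B3)) else 0)"
      using card_rare3_le[of k B1 B2 B3] by (auto intro!: divide_left_mono)
  qed
  then show ?thesis
    unfolding expect3_cmult expect3_rare[OF assms] by simp
qed

lemma sum_uniform:
  assumes "R \<subseteq> I" "finite I" "R \<noteq> {}"
  shows "(\<Sum>c\<in>I. if c \<in> R then 1 / real (card R) else 0) = 1"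
proof -
  have "finite R" using assms finite_subset by blast
  then show ?thesis using assms
    by (simp add: sum.inter_restrict[symmetric] Int_absorb1)
qed

lemma sum_pdl_empty_ge:
  assumes "c \<in> chunks k"
  shows "3 * pop k x c * (1 - pop k x c)\<^sup>2 \<le> (\<Sum>j\<in>chunks k. pdl k x {} j)"
  unfolding pdl_empty sum_expect3 expect3_rare[OF assms, symmetric]
proof (rule expect3_mono)
  fix B1 B2 B3
  show "of_bool (c \<in> rare3 k B1 B2 B3) \<le> (\<Sum>j\<in>chunks k.
      if j \<in> rare3 k B1 B2 B3 then 1 / real (card (rare3 k B1 B2 B3)) else 0)"
  proof (cases "rare3 k B1 B2 B3 = {}")
    case False
    have "(\<Sum>j\<in>chunks k. if j \<in> rare3 k B1 B2 B3 then 1 / real (card (rare3 k B1 B2 B3)) else 0) = 1"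
      by (rule sum_uniform) (use False in \<open>auto simp: rare3_def\<close>)
    then show ?thesis by simp
  qed simp
qed

lemma sum_pdl_mid_ge:
  assumes "c \<in> chunks k - A" "A \<noteq> {}" "card A \<le> k - 2"
  shows "pop k x c \<le> (\<Sum>j\<in>chunks k - A. pdl k x A j)"
proof -
  have c: "c \<in> chunks k" using assms by simp
  have pdl: "pdl k x A j = expect k x (\<lambda>B. if j \<in> B - A then 1 / real (card (B - A)) else 0)" for j
    using assms by (simp add: pdl_def expect_def)
  show ?thesis
    unfolding pdl sum_expect expect_mem[OF c, symmetric]
  proof (rule expect_mono)
    fix B assume B: "B \<subseteq> chunks k"
    show "of_bool (c \<in> B)
      \<le> (\<Sum>j\<in>chunks k - A. if j \<in> B - A then 1 / real (card (B - A)) else 0)"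
    proof (cases "c \<in> B")
      case True
      have "(\<Sum>j\<in>chunks k - A. if j \<in> B - A then 1 / real (card (B - A)) else 0) = 1"
        by (rule sum_uniform) (use B True assms in auto)
      then show ?thesis by simp
    qed (simp add: sum_nonneg)
  qed
qed

lemma pdl_last:
  assumes "2 \<le> k" "card A = k - 1"
  shows "pdl k x A c = expect3 k x (\<lambda>B1 B2 B3.
    of_bool (c \<in> B1 \<union> B2 \<union> B3 \<and> (\<forall>i\<in>A. 2 \<le> cnt3 i B1 B2 B3)))"
proof -
  have "A \<noteq> {}" "\<not> card A \<le> k - 2" using assms by auto
  then show ?thesis by (simp add: pdl_def expect3_def of_bool_def)
qed

lemma pdl_last_le:
  assumes "2 \<le> k" "card A = k - 1" "i \<in> A" "i \<in> chunks k"
  shows "pdl k x A c \<le> 3 * (pop k x i)\<^sup>2"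
proof -
  have "pdl k x A c \<le> expect3 k x (\<lambda>B1 B2 B3.
      of_bool (i \<in> B1) * of_bool (i \<in> B2) * 1 + of_bool (i \<in> B1) * 1 * of_bool (i \<in> B3)
      + 1 * of_bool (i \<in> B2) * of_bool (i \<in> B3))"
    unfolding pdl_last[OF assms(1,2)]
  proof (rule expect3_mono)
    fix B1 B2 B3
    have "2 \<le> cnt3 i B1 B2 B3 \<longleftrightarrow> (i \<in> B1 \<and> i \<in> B2) \<or> (i \<in> B1 \<and> i \<in> B3) \<or> (i \<in> B2 \<and> i \<in> B3)"
      by (simp add: cnt3_def)
    then show "of_bool (c \<in> B1 \<union> B2 \<union> B3 \<and> (\<forall>i\<in>A. 2 \<le> cnt3 i B1 B2 B3))
       \<le> of_bool (i \<in> B1) * of_bool (i \<in> B2) * 1 + of_bool (i \<in> B1) * 1 * of_bool (i \<in> B3)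
      + 1 * of_bool (i \<in> B2) * (of_bool (i \<in> B3) :: real)"
      using assms(3) by auto
  qed
  also have "\<dots> = 3 * (pop k x i)\<^sup>2"
    by (simp only: expect3_add expect3_prod expect_mem[OF assms(4)] expect_const)
      (simp add: power2_eq_square)
  finally show ?thesis .
qed

lemma pdl_last_ge:
  assumes "2 \<le> k" "c \<in> chunks k"
  shows "3 * pop k x c * (w k x (chunks k - {c}))\<^sup>2 \<le> pdl k x (chunks k - {c}) c"
proof -
  let ?A = "chunks k - {c}"
  have card: "card ?A = k - 1" using assms by simp
  have sub: "?A \<subseteq> chunks k" by auto
  have "expect3 k x (\<lambda>B1 B2 B3.
      of_bool (c \<in> B1) * of_bool (B2 = ?A) * of_bool (B3 = ?A)
      + of_bool (B1 = ?A) * of_bool (c \<in> B2) * of_bool (B3 = ?A)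
      + of_bool (B1 = ?A) * of_bool (B2 = ?A) * of_bool (c \<in> B3)) \<le> pdl k x ?A c"
    unfolding pdl_last[OF assms(1) card]
  proof (rule expect3_mono)
    fix B1 B2 B3
    show "of_bool (c \<in> B1) * of_bool (B2 = ?A) * of_bool (B3 = ?A)
      + of_bool (B1 = ?A) * of_bool (c \<in> B2) * of_bool (B3 = ?A)
      + of_bool (B1 = ?A) * of_bool (B2 = ?A) * of_bool (c \<in> B3)
      \<le> (of_bool (c \<in> B1 \<union> B2 \<union> B3 \<and> (\<forall>i\<in>?A. 2 \<le> cnt3 i B1 B2 B3)) :: real)"
      by (cases "B1 = ?A"; cases "B2 = ?A"; cases "B3 = ?A") (simp_all add: cnt3_def)
  qed
  also have "expect3 k x (\<lambda>B1 B2 B3.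
      of_bool (c \<in> B1) * of_bool (B2 = ?A) * of_bool (B3 = ?A)
      + of_bool (B1 = ?A) * of_bool (c \<in> B2) * of_bool (B3 = ?A)
      + of_bool (B1 = ?A) * of_bool (B2 = ?A) * of_bool (c \<in> B3))
     = 3 * pop k x c * (w k x ?A)\<^sup>2"
    by (simp only: expect3_add expect3_prod expect_mem[OF assms(2)] expect_eq[OF sub])
      (simp add: power2_eq_square)
  finally show ?thesis .
qed

lemma pdl_nonneg: "0 \<le> pdl k x A c"
  unfolding pdl_def
  by (simp only: split: if_split) (intro conjI impI sum_nonneg mult_nonneg_nonneg w_nonneg; simp)

subsection \<open>Download rates\<close>

definition mids :: "nat \<Rightarrow> nat set set" where
  "mids k = {A \<in> profiles k. A \<noteq> {} \<and> card A \<le> k - 2}"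

definition mid_lacking :: "nat \<Rightarrow> state \<Rightarrow> nat \<Rightarrow> real" where
  "mid_lacking k x c = (\<Sum>A\<in>mids k. real (x A) * of_bool (c \<notin> A)) / real (S k x)"

definition empties :: "nat \<Rightarrow> state \<Rightarrow> real" where
  "empties k x = real (S0 x) / real (S k x)"

definition only_lacking :: "nat \<Rightarrow> state \<Rightarrow> nat \<Rightarrow> real" where
  "only_lacking k x c = real (x (chunks k - {c})) / real (S k x)"

definition dl_rate :: "nat \<Rightarrow> state \<Rightarrow> real" where
  "dl_rate k x = (\<Sum>A\<in>profiles k. \<Sum>c\<in>chunks k - A. real (x A) * pdl k x A c)"

lemma last_profile_eq:
  assumes "A \<in> profiles k" "card A = k - 1"
  shows "\<exists>c\<in>chunks k. A = chunks k - {c}"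
proof -
  have sub: "A \<subset> chunks k" using assms(1) by (simp add: profiles_def)
  then obtain c where c: "c \<in> chunks k" "c \<notin> A" by auto
  have "A = chunks k - {c}"
    using c sub assms(2) by (intro card_subset_eq) auto
  then show ?thesis using c by auto
qed

lemma sum_profiles:
  fixes g :: "nat set \<Rightarrow> real"
  assumes "2 \<le> k"
  shows "(\<Sum>A\<in>profiles k. g A) = g {} + (\<Sum>A\<in>mids k. g A) + (\<Sum>c\<in>chunks k. g (chunks k - {c}))"
proof -
  let ?L = "(\<lambda>c. chunks k - {c}) ` chunks k"
  have card: "card (chunks k - {c}) = k - 1" if "c \<in> chunks k" for c
    using that by simp
  have "A \<in> insert {} (mids k) \<union> ?L" if A: "A \<in> profiles k" for A
  proof (cases "card A \<le> k - 2")
    case True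
    then show ?thesis using A by (auto simp: mids_def)
  next
    case False
    then have "card A = k - 1" using card_profile_less[OF A] by simp
    then show ?thesis using last_profile_eq[OF A] by auto
  qed
  moreover have "chunks k - {c} \<in> profiles k" if "c \<in> chunks k" for c
    using that by (auto simp: profiles_def)
  ultimately have eq: "profiles k = insert {} (mids k) \<union> ?L"
    using empty_in_profiles[of k] assms by (auto simp: mids_def)
  have fin: "finite (mids k)" by (simp add: mids_def)
  have "card A = k - 1 \<and> A \<noteq> {}" if "A \<in> ?L" for A
  proof -
    obtain c where "c \<in> chunks k" "A = chunks k - {c}" using \<open>A \<in> ?L\<close> by blast
    then have "card A = k - 1" using card by simp
    then show ?thesis using assms by auto
  qed
  then have "insert {} (mids k) \<inter> ?L = {}"
    using assms by (fastforce simp: mids_def)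
  then have "sum g (profiles k) = sum g (insert {} (mids k)) + sum g ?L"
    unfolding eq using fin by (intro sum.union_disjoint) auto
  moreover have "sum g ?L = (\<Sum>c\<in>chunks k. g (chunks k - {c}))"
    by (subst sum.reindex) (auto simp: inj_on_def)
  moreover have "sum g (insert {} (mids k)) = g {} + sum g (mids k)"
    using fin by (subst sum.insert) (auto simp: mids_def)
  ultimately show ?thesis by simp
qed

lemma pop_nonneg: "0 \<le> pop k x c" and pop_le_one: "pop k x c \<le> 1"
  using Si_le_S[of k x c] S_pos[of k x] by (simp_all add: pop_def)

lemma empties_nonneg: "0 \<le> empties k x"
  by (simp add: empties_def)

lemma only_lacking_nonneg: "0 \<le> only_lacking k x c"
  by (simp add: only_lacking_def)

lemma mid_lacking_nonneg: "0 \<le> mid_lacking k x c"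
  by (simp add: mid_lacking_def sum_nonneg)

lemma w_last: "c \<in> chunks k \<Longrightarrow> w k x (chunks k - {c}) = only_lacking k x c"
  by (auto simp: w_def npeers_def only_lacking_def)

lemma one_minus_pop:
  assumes "2 \<le> k" "c \<in> chunks k"
  shows "1 - pop k x c = empties k x + mid_lacking k x c + only_lacking k x c"
proof -
  have "(\<Sum>j\<in>chunks k. real (x (chunks k - {j})) * of_bool (c \<notin> chunks k - {j}))
      = (\<Sum>j\<in>chunks k. if j = c then real (x (chunks k - {j})) else 0)"
    using assms(2) by (intro sum.cong) auto
  then have "(\<Sum>A\<in>profiles k. real (x A) * of_bool (c \<notin> A))
      = real (x {}) + (\<Sum>A\<in>mids k. real (x A) * of_bool (c \<notin> A)) + real (x (chunks k - {c}))"
    unfolding sum_profiles[OF assms(1)] using assms(2) by simp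
  then show ?thesis
    unfolding expect_not_mem[OF assms(2), symmetric] expect_alt
    using assms(2) by (simp add: empties_def mid_lacking_def only_lacking_def S0_def add_divide_distrib)
qed

lemma pop_ge_sum_only_lacking:
  assumes "2 \<le> k" "c \<in> chunks k"
  shows "(\<Sum>j\<in>chunks k - {c}. only_lacking k x j) \<le> pop k x c"
proof -
  have "(\<Sum>j\<in>chunks k - {c}. real (x (chunks k - {j})))
      = (\<Sum>j\<in>chunks k. real (x (chunks k - {j})) * of_bool (c \<in> chunks k - {j}))"
    using assms(2) by (intro sum.mono_neutral_cong_left) auto
  also have "\<dots> \<le> (\<Sum>A\<in>profiles k. real (x A) * of_bool (c \<in> A))"
    unfolding sum_profiles[OF assms(1)] by (simp add: sum_nonneg)
  finally show ?thesis
    unfolding expect_mem[OF assms(2), symmetric] expect_alt only_lacking_def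
    using assms(2) S_pos[of k x] by (simp add: sum_divide_distrib[symmetric] divide_right_mono)
qed

lemma sum_fractions_ge:
  assumes "2 \<le> k"
  shows "1 - 1 / real (S k x)
    \<le> empties k x + (\<Sum>c\<in>chunks k. mid_lacking k x c) + (\<Sum>c\<in>chunks k. only_lacking k x c)"
proof -
  have "1 \<le> (\<Sum>c\<in>chunks k. of_bool (c \<notin> A) :: real)" if "A \<in> mids k" for A
  proof -
    obtain c where c: "c \<in> chunks k" "c \<notin> A"
      using \<open>A \<in> mids k\<close> by (auto simp: mids_def profiles_def)
    then show ?thesis
      using member_le_sum[of c "chunks k" "\<lambda>c. of_bool (c \<notin> A) :: real"] by simp
  qed
  then have "(\<Sum>A\<in>mids k. real (x A) * 1) \<le> (\<Sum>A\<in>mids k. real (x A) * (\<Sum>c\<in>chunks k. of_bool (c \<notin> A)))"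
    by (intro sum_mono mult_left_mono) auto
  also have "\<dots> = (\<Sum>c\<in>chunks k. \<Sum>A\<in>mids k. real (x A) * of_bool (c \<notin> A))"
    unfolding sum_distrib_left by (rule sum.swap)
  finally have "real (S k x) - 1 \<le> real (S0 x)
      + (\<Sum>c\<in>chunks k. \<Sum>A\<in>mids k. real (x A) * of_bool (c \<notin> A))
      + (\<Sum>c\<in>chunks k. real (x (chunks k - {c})))"
    using sum_profiles[OF assms, of "\<lambda>A. real (x A)"] by (simp add: S_def S0_def)
  from divide_right_mono[OF this, of "real (S k x)"] show ?thesis
    using S_pos[of k x]
    by (simp add: empties_def mid_lacking_def only_lacking_def sum_divide_distrib[symmetric]
        add_divide_distrib diff_divide_distrib)
qed

lemma dl_rate_eq:
  assumes "2 \<le> k"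
  shows "dl_rate k x = real (S0 x) * (\<Sum>c\<in>chunks k. pdl k x {} c)
    + (\<Sum>A\<in>mids k. real (x A) * (\<Sum>c\<in>chunks k - A. pdl k x A c))
    + (\<Sum>c\<in>chunks k. real (x (chunks k - {c})) * pdl k x (chunks k - {c}) c)"
proof -
  have "(\<Sum>c\<in>chunks k. \<Sum>j\<in>chunks k - (chunks k - {c}). real (x (chunks k - {c})) * pdl k x (chunks k - {c}) j)
      = (\<Sum>c\<in>chunks k. real (x (chunks k - {c})) * pdl k x (chunks k - {c}) c)"
  proof (intro sum.cong refl)
    fix c assume "c \<in> chunks k"
    then have "chunks k - (chunks k - {c}) = {c}" by auto
    then show "(\<Sum>j\<in>chunks k - (chunks k - {c}). real (x (chunks k - {c})) * pdl k x (chunks k - {c}) j)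
       = real (x (chunks k - {c})) * pdl k x (chunks k - {c}) c" by simp
  qed
  then show ?thesis
    unfolding dl_rate_def sum_profiles[OF assms] by (simp add: sum_distrib_left S0_def)
qed

lemma dl_rate_ge_empties:
  assumes "2 \<le> k"
  shows "real (S0 x) * (\<Sum>c\<in>chunks k. pdl k x {} c) \<le> dl_rate k x"
  unfolding dl_rate_eq[OF assms] by (simp add: sum_nonneg pdl_nonneg)

lemma dl_rate_ge:
  assumes "2 \<le> k" "c \<in> chunks k"
  shows "pop k x c * (3 * empties k x * (1 - pop k x c)\<^sup>2 + mid_lacking k x c + 3 * only_lacking k x c ^ 3)
    \<le> dl_rate k x / real (S k x)"
proof -
  let ?s = "real (S k x)" and ?p = "pop k x c" and ?a = "only_lacking k x c"
  have s: "?s > 0" using S_pos[of k x] by simp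
  have 1: "real (S0 x) * (3 * ?p * (1 - ?p)\<^sup>2) \<le> real (S0 x) * (\<Sum>c\<in>chunks k. pdl k x {} c)"
    by (intro mult_left_mono sum_pdl_empty_ge assms) simp
  have "(\<Sum>A\<in>mids k. real (x A) * of_bool (c \<notin> A) * ?p)
      \<le> (\<Sum>A\<in>mids k. real (x A) * (\<Sum>c\<in>chunks k - A. pdl k x A c))"
  proof (intro sum_mono)
    fix A assume A: "A \<in> mids k"
    show "real (x A) * of_bool (c \<notin> A) * ?p \<le> real (x A) * (\<Sum>c\<in>chunks k - A. pdl k x A c)"
    proof (cases "c \<in> A")
      case False
      then have "?p \<le> (\<Sum>c\<in>chunks k - A. pdl k x A c)"
        using A assms by (intro sum_pdl_mid_ge) (auto simp: mids_def)
      then show ?thesis using False by (simp add: mult_left_mono)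
    qed (simp add: sum_nonneg pdl_nonneg)
  qed
  then have 2: "mid_lacking k x c * ?s * ?p
      \<le> (\<Sum>A\<in>mids k. real (x A) * (\<Sum>c\<in>chunks k - A. pdl k x A c))"
    unfolding sum_distrib_right[symmetric] using s by (simp add: mid_lacking_def)
  have "?a * ?s * (3 * ?p * ?a\<^sup>2) \<le> real (x (chunks k - {c})) * pdl k x (chunks k - {c}) c"
    using pdl_last_ge[OF assms, of x] s unfolding w_last[OF assms(2)]
    by (simp add: only_lacking_def mult_left_mono)
  also have "\<dots> \<le> (\<Sum>c\<in>chunks k. real (x (chunks k - {c})) * pdl k x (chunks k - {c}) c)"
    using assms(2)
      member_le_sum[of c "chunks k" "\<lambda>c. real (x (chunks k - {c})) * pdl k x (chunks k - {c}) c"]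
    by (simp add: pdl_nonneg)
  finally have 3: "?a * ?s * (3 * ?p * ?a\<^sup>2)
      \<le> (\<Sum>c\<in>chunks k. real (x (chunks k - {c})) * pdl k x (chunks k - {c}) c)" .
  have n: "real (S0 x) = empties k x * ?s"
    using s by (simp add: empties_def)
  have "?p * (3 * empties k x * (1 - ?p)\<^sup>2 + mid_lacking k x c + 3 * ?a ^ 3) * ?s
      = real (S0 x) * (3 * ?p * (1 - ?p)\<^sup>2) + mid_lacking k x c * ?s * ?p + ?a * ?s * (3 * ?p * ?a\<^sup>2)"
    unfolding n by (simp add: power2_eq_square power3_eq_cube algebra_simps)
  also have "\<dots> \<le> dl_rate k x"
    using 1 2 3 unfolding dl_rate_eq[OF assms(1)] by linarith
  finally show ?thesis using s by (simp add: pos_le_divide_eq)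
qed

lemma dl_rate_nonneg: "0 \<le> dl_rate k x"
  unfolding dl_rate_def by (intro sum_nonneg mult_nonneg_nonneg pdl_nonneg) simp

lemma drift_Lyap_le:
  fixes x k
  defines "s \<equiv> real (S k x)"
  assumes "2 \<le> k" "0 \<le> lam"
  shows "drift k lam (Lyap k C) x
    \<le> lam * (C * real k + real k + 1 - (1 - exp (-1)) * (s * exp (- real (S0 x))))
      - C * dl_rate k x
      + (exp 1 - 1) * (s * exp (- real (S0 x))) * (real (S0 x) * (\<Sum>c\<in>chunks k. pdl k x {} c))
      - (1 - exp (-1)) * (\<Sum>c\<in>chunks k. real (S0 x) * pdl k x {} c * (s * exp (- real (Si k x c))))
      + (\<Sum>i\<in>chunks k. 3 * (exp 1 - 1) * (real (Si k x i) ^ 3 * exp (- real (Si k x i))) / s)"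
proof -
  define g where "g i = (exp 1 - 1) * (s * exp (- real (Si k x i)))" for i
  define h where "h c = (exp 1 - 1) * (s * exp (- real (S0 x)))
      - (1 - exp (-1)) * (s * exp (- real (Si k x c)))" for c
  have s: "s > 0" using S_pos[of k x] by (simp add: s_def)
  have g: "0 \<le> g i" for i using s by (simp add: g_def)
  define r where "r A c = real (x A) * pdl k x A c" for A c
  have r: "0 \<le> r A c" for A c by (simp add: r_def pdl_nonneg)
  have "(\<Sum>A\<in>profiles k. \<Sum>c\<in>chunks k - A. r A c * (Lyap k C (move k x A c) - Lyap k C x))
     \<le> (\<Sum>A\<in>profiles k. \<Sum>c\<in>chunks k - A. r A c * (- C + (if A = {} then h c else 0)
         + (if card A = k - 1 then \<Sum>i\<in>A. g i else 0)))"
  proof (intro sum_mono)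
    fix A c assume A: "A \<in> profiles k" and c: "c \<in> chunks k - A"
    show "r A c * (Lyap k C (move k x A c) - Lyap k C x)
        \<le> r A c * (- C + (if A = {} then h c else 0) + (if card A = k - 1 then \<Sum>i\<in>A. g i else 0))"
    proof (cases "x A = 0")
      case False
      then have "0 < x A" by simp
      from mult_left_mono[OF Lyap_move_le[where x = x, OF assms(2) this A c, of C] r[of A c]] show ?thesis
        by (simp only: h_def g_def s_def)
    qed (simp add: r_def)
  qed
  also have "\<dots> = - C * dl_rate k x
      + (\<Sum>A\<in>profiles k. \<Sum>c\<in>chunks k - A. r A c * (if A = {} then h c else 0))
      + (\<Sum>A\<in>profiles k. \<Sum>c\<in>chunks k - A. r A c * (if card A = k - 1 then \<Sum>i\<in>A. g i else 0))"
    unfolding dl_rate_def r_def sum_distrib_left sum.distrib[symmetric]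
    by (intro sum.cong refl) (simp add: algebra_simps)
  also have "(\<Sum>A\<in>profiles k. \<Sum>c\<in>chunks k - A. r A c * (if A = {} then h c else 0))
      = (\<Sum>A\<in>profiles k. if A = {} then (\<Sum>c\<in>chunks k. r {} c * h c) else 0)"
    by (intro sum.cong) auto
  also have "\<dots> = (\<Sum>c\<in>chunks k. r {} c * h c)"
    using empty_in_profiles[of k] assms(2) by simp
  also have "\<dots> = (exp 1 - 1) * (s * exp (- real (S0 x))) * (real (S0 x) * (\<Sum>c\<in>chunks k. pdl k x {} c))
      - (1 - exp (-1)) * (\<Sum>c\<in>chunks k. real (S0 x) * pdl k x {} c * (s * exp (- real (Si k x c))))"
    unfolding r_def h_def S0_def sum_distrib_left sum_subtractf[symmetric]
    by (intro sum.cong refl) (simp add: algebra_simps)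
  also have "(\<Sum>A\<in>profiles k. \<Sum>c\<in>chunks k - A. r A c * (if card A = k - 1 then \<Sum>i\<in>A. g i else 0))
      \<le> (\<Sum>i\<in>chunks k. 3 * (pop k x i)\<^sup>2 * g i * (s * pop k x i))"
  proof -
    have "(\<Sum>A\<in>profiles k. \<Sum>c\<in>chunks k - A. r A c * (if card A = k - 1 then \<Sum>i\<in>A. g i else 0))
        = (\<Sum>c\<in>chunks k. \<Sum>j\<in>chunks k - (chunks k - {c}). r (chunks k - {c}) j * (\<Sum>i\<in>chunks k - {c}. g i))"
    proof -
      have "(\<Sum>A\<in>mids k. \<Sum>c\<in>chunks k - A. r A c * (if card A = k - 1 then \<Sum>i\<in>A. g i else 0)) = 0"
        using assms(2) by (intro sum.neutral ballI) (auto simp: mids_def)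
      then show ?thesis
        unfolding sum_profiles[OF assms(2)] using assms(2) by simp
    qed
    also have "\<dots> = (\<Sum>c\<in>chunks k. \<Sum>i\<in>chunks k - {c}. r (chunks k - {c}) c * g i)"
    proof (rule sum.cong[OF refl])
      fix c assume "c \<in> chunks k"
      then have "chunks k - (chunks k - {c}) = {c}" by auto
      then show "(\<Sum>j\<in>chunks k - (chunks k - {c}). r (chunks k - {c}) j * (\<Sum>i\<in>chunks k - {c}. g i))
        = (\<Sum>i\<in>chunks k - {c}. r (chunks k - {c}) c * g i)"
        by (simp add: sum_distrib_left)
    qed
    also have "\<dots> \<le> (\<Sum>c\<in>chunks k. \<Sum>i\<in>chunks k - {c}. 3 * (pop k x i)\<^sup>2 * g i * (s * only_lacking k x c))"
    proof (intro sum_mono)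
      fix c i assume c: "c \<in> chunks k" and i: "i \<in> chunks k - {c}"
      have "pdl k x (chunks k - {c}) c \<le> 3 * (pop k x i)\<^sup>2"
        using c i assms(2) by (intro pdl_last_le) auto
      then have "real (x (chunks k - {c})) * pdl k x (chunks k - {c}) c * g i
          \<le> real (x (chunks k - {c})) * (3 * (pop k x i)\<^sup>2) * g i"
        by (intro mult_right_mono mult_left_mono g) auto
      then show "r (chunks k - {c}) c * g i \<le> 3 * (pop k x i)\<^sup>2 * g i * (s * only_lacking k x c)"
        using s by (simp add: r_def only_lacking_def s_def[symmetric] mult_ac)
    qed
    also have "\<dots> = (\<Sum>i\<in>chunks k. \<Sum>c\<in>chunks k - {i}. 3 * (pop k x i)\<^sup>2 * g i * (s * only_lacking k x c))"
    proof -
      have "(\<Sum>i\<in>{i\<in>chunks k. i \<noteq> c}. f i) = (\<Sum>i\<in>chunks k - {c}. f i)" for c and f :: "nat \<Rightarrow> real"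
        by (intro sum.cong) auto
      moreover have "(\<Sum>c\<in>{c\<in>chunks k. i \<noteq> c}. f c) = (\<Sum>c\<in>chunks k - {i}. f c)" for i and f :: "nat \<Rightarrow> real"
        by (intro sum.cong) auto
      ultimately show ?thesis
        using sum.swap_restrict[of "chunks k" "chunks k"
            "\<lambda>c i. 3 * (pop k x i)\<^sup>2 * g i * (s * only_lacking k x c)" "\<lambda>c i. i \<noteq> c"]
        by simp
    qed
    also have "\<dots> \<le> (\<Sum>i\<in>chunks k. 3 * (pop k x i)\<^sup>2 * g i * (s * pop k x i))"
      unfolding sum_distrib_left[symmetric]
      using s by (intro sum_mono mult_left_mono pop_ge_sum_only_lacking assms(2) mult_nonneg_nonneg g) auto
    finally show ?thesis .
  qed
  also have "(\<Sum>i\<in>chunks k. 3 * (pop k x i)\<^sup>2 * g i * (s * pop k x i))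
      = (\<Sum>i\<in>chunks k. 3 * (exp 1 - 1) * (real (Si k x i) ^ 3 * exp (- real (Si k x i))) / s)"
    using s by (intro sum.cong refl)
      (simp add: g_def pop_def s_def[symmetric] power2_eq_square power3_eq_cube field_simps)
  finally have "(\<Sum>A\<in>profiles k. \<Sum>c\<in>chunks k - A. r A c * (Lyap k C (move k x A c) - Lyap k C x))
      \<le> - C * dl_rate k x
      + ((exp 1 - 1) * (s * exp (- real (S0 x))) * (real (S0 x) * (\<Sum>c\<in>chunks k. pdl k x {} c))
      - (1 - exp (-1)) * (\<Sum>c\<in>chunks k. real (S0 x) * pdl k x {} c * (s * exp (- real (Si k x c)))))
      + (\<Sum>i\<in>chunks k. 3 * (exp 1 - 1) * (real (Si k x i) ^ 3 * exp (- real (Si k x i))) / s)"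
    by simp
  moreover have "lam * (Lyap k C (arrival x) - Lyap k C x)
      \<le> lam * (C * real k + real k + 1 - (1 - exp (-1)) * (s * exp (- real (S0 x))))"
    unfolding s_def using assms by (intro mult_left_mono Lyap_arrival_le) auto
  ultimately show ?thesis
    unfolding drift_eq r_def by linarith
qed

subsection \<open>The cost of downloads by empty peers\<close>

lemma mult_exp_minus_le: "(y::real) * exp (- y) \<le> 1 / 2"
proof -
  have "y \<le> exp (y - 1)" using exp_ge_add_one_self[of "y - 1"] by simp
  then have "y * exp (- y) \<le> exp (y - 1) * exp (- y)" by (intro mult_right_mono) auto
  also have "\<dots> = exp (- 1)" by (simp add: exp_add[symmetric])
  also have "\<dots> \<le> 1 / 2"
    using exp_ge_add_one_self[of "1::real"] by (simp add: exp_minus field_simps)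
  finally show ?thesis .
qed

lemma power_mult_exp_minus_le:
  assumes "0 \<le> (y::real)" "0 < n"
  shows "y ^ n * exp (- y) \<le> (real n / 2) ^ n"
proof -
  have "(y / real n * exp (- (y / real n))) ^ n \<le> (1 / 2) ^ n"
    using assms by (intro power_mono mult_exp_minus_le) auto
  then have "real n ^ n * (y / real n * exp (- (y / real n))) ^ n \<le> real n ^ n * (1 / 2) ^ n"
    by (intro mult_left_mono) auto
  moreover have "exp (- (y / real n)) ^ n = exp (- y)"
    using assms by (simp add: exp_of_nat_mult[symmetric])
  ultimately show ?thesis
    using assms by (simp add: power_mult_distrib power_divide)
qed

lemma mult_exp_minus_antimono:
  assumes "1 \<le> (y::real)" "y \<le> z"
  shows "z * exp (- z) \<le> y * exp (- y)"
proof -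
  have "z \<le> y * (1 + (z - y))"
    using mult_nonneg_nonneg[of "y - 1" "z - y"] assms by (simp add: algebra_simps)
  also have "\<dots> \<le> y * exp (z - y)"
    using exp_ge_add_one_self[of "z - y"] assms by (intro mult_left_mono) auto
  finally have "z * exp (- z) \<le> y * exp (z - y) * exp (- z)"
    by (intro mult_right_mono) auto
  also have "\<dots> = y * exp (- y)" by (simp add: mult.assoc exp_add[symmetric])
  finally show ?thesis .
qed

lemma exists_ge_average:
  fixes f :: "'a \<Rightarrow> real"
  assumes "finite I" "real (card I) * b \<le> sum f I" "I \<noteq> {}"
  shows "\<exists>c\<in>I. b \<le> f c"
proof (rule ccontr)
  assume "\<not> ?thesis"
  then have "sum f I < (\<Sum>c\<in>I. b)"
    using assms by (intro sum_strict_mono) auto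
  then show False using assms by simp
qed

lemma chunks_nonempty: "2 \<le> k \<Longrightarrow> chunks k \<noteq> {}"
  by (auto simp: chunks_def)

lemma exists_pop_le:
  assumes "2 \<le> k" "empties k x \<le> 1 / 8" "8 \<le> S k x"
  shows "\<exists>c\<in>chunks k. pop k x c \<le> 3 * real k ^ 3 * (dl_rate k x / real (S k x))"
proof -
  let ?t = "dl_rate k x / real (S k x)" and ?K = "real k"
  have K: "2 \<le> ?K" using assms by simp
  have t: "0 \<le> ?t" by (simp add: dl_rate_nonneg)
  have "4 \<le> ?K * ?K" using mult_mono[of 2 ?K 2 ?K] K by simp
  then have "?K * 4 \<le> ?K * (?K * ?K)" using K by (intro mult_left_mono) auto
  then have K3: "4 * ?K \<le> ?K ^ 3" by (simp add: power3_eq_cube)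
  have *: "pop k x c * mid_lacking k x c \<le> ?t \<and> pop k x c * (3 * only_lacking k x c ^ 3) \<le> ?t"
    if "c \<in> chunks k" for c
  proof -
    have "0 \<le> pop k x c * (3 * empties k x * (1 - pop k x c)\<^sup>2)"
      "0 \<le> pop k x c * mid_lacking k x c" "0 \<le> pop k x c * (3 * only_lacking k x c ^ 3)"
      by (simp_all add: pop_nonneg empties_nonneg mid_lacking_nonneg only_lacking_nonneg)
    then show ?thesis
      using dl_rate_ge[OF assms(1) that, of x] unfolding distrib_left by linarith
  qed
  have "1 / real (S k x) \<le> 1 / 8" using assms(3) by (simp add: field_simps)
  then have tot: "3 / 4 \<le> (\<Sum>c\<in>chunks k. mid_lacking k x c) + (\<Sum>c\<in>chunks k. only_lacking k x c)"
    using sum_fractions_ge[OF assms(1), of x] assms(2) by linarith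
  show ?thesis
  proof (cases "1 / 2 \<le> (\<Sum>c\<in>chunks k. only_lacking k x c)")
    case True
    then obtain c where c: "c \<in> chunks k" "1 / (2 * ?K) \<le> only_lacking k x c"
      using exists_ge_average[of "chunks k" "1 / (2 * ?K)" "only_lacking k x"] K
        chunks_nonempty[OF assms(1)] by auto
    have "(1 / (2 * ?K)) ^ 3 \<le> only_lacking k x c ^ 3"
      using c(2) K by (intro power_mono) auto
    then have "pop k x c * (3 * (1 / (2 * ?K)) ^ 3) \<le> pop k x c * (3 * only_lacking k x c ^ 3)"
      by (intro mult_left_mono) (auto simp: pop_nonneg)
    also have "\<dots> \<le> ?t" using *[OF c(1)] by simp
    finally have "pop k x c * 3 \<le> 8 * ?K ^ 3 * ?t"
      using K by (simp add: power_divide power_mult_distrib field_simps)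
    moreover have "0 \<le> ?K ^ 3 * ?t" using t by (intro mult_nonneg_nonneg) auto
    ultimately have "pop k x c \<le> 3 * ?K ^ 3 * ?t" by linarith
    then show ?thesis using c by blast
  next
    case False
    then have "1 / 4 \<le> (\<Sum>c\<in>chunks k. mid_lacking k x c)" using tot by linarith
    then obtain c where c: "c \<in> chunks k" "1 / (4 * ?K) \<le> mid_lacking k x c"
      using exists_ge_average[of "chunks k" "1 / (4 * ?K)" "mid_lacking k x"] K
        chunks_nonempty[OF assms(1)] by auto
    have "pop k x c * (1 / (4 * ?K)) \<le> pop k x c * mid_lacking k x c"
      by (intro mult_left_mono c(2) pop_nonneg)
    also have "\<dots> \<le> ?t" using *[OF c(1)] by simp
    finally have "pop k x c \<le> 4 * ?K * ?t" using K by (simp add: field_simps)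
    also have "\<dots> \<le> ?K ^ 3 * ?t" using K3 t by (rule mult_right_mono)
    also have "\<dots> \<le> 3 * ?K ^ 3 * ?t" using t mult_nonneg_nonneg[of "?K ^ 3" ?t] by simp
    finally show ?thesis using c by blast
  qed
qed

lemma sum_pop_lacking_le:
  assumes "2 \<le> k" "empties k x \<le> 1 / 8" "8 \<le> S k x"
  shows "(\<Sum>c\<in>chunks k. pop k x c * (mid_lacking k x c + only_lacking k x c)\<^sup>2)
    \<le> 7 * real k ^ 3 * (dl_rate k x / real (S k x))"
proof -
  let ?t = "dl_rate k x / real (S k x)" and ?K = "real k"
  let ?p = "pop k x" and ?m = "mid_lacking k x" and ?a = "only_lacking k x"
  have K: "2 \<le> ?K" using assms by simp
  have t: "0 \<le> ?t" by (simp add: dl_rate_nonneg)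
  note nn = pop_nonneg[of k x] empties_nonneg[of k x] mid_lacking_nonneg[of k x]
    only_lacking_nonneg[of k x]
  obtain j where j: "j \<in> chunks k" "?p j \<le> 3 * ?K ^ 3 * ?t"
    using exists_pop_le[OF assms] by blast
  have "?p c * (?m c + ?a c)\<^sup>2 \<le> 2 * ?t + (if c = j then ?p j else ?a c)" if c: "c \<in> chunks k" for c
  proof -
    have sum1: "?m c + ?a c \<le> 1" "?a c \<le> 1"
      using one_minus_pop[OF assms(1) c, of x] nn(1)[of c] nn(2) nn(3)[of c] nn(4)[of c]
      by linarith+
    have "0 \<le> ?p c * (3 * empties k x * (1 - ?p c)\<^sup>2)" "0 \<le> ?p c * (3 * ?a c ^ 3)"
      using nn by simp_all
    then have m: "?p c * ?m c \<le> ?t"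
      using dl_rate_ge[OF assms(1) c, of x] unfolding distrib_left by linarith
    have "(?m c + ?a c)\<^sup>2 = ?m c * ((?m c + ?a c) + ?a c) + ?a c * ?a c"
      by (simp add: power2_eq_square algebra_simps)
    also have "\<dots> \<le> ?m c * 2 + ?a c * ?a c"
      using sum1 nn by (intro add_mono mult_left_mono order_refl) auto
    finally have "?p c * (?m c + ?a c)\<^sup>2 \<le> ?p c * (?m c * 2 + ?a c * ?a c)"
      by (intro mult_left_mono nn)
    also have "\<dots> = 2 * (?p c * ?m c) + ?p c * (?a c * ?a c)"
      by (simp add: algebra_simps)
    also have "\<dots> \<le> 2 * ?t + (if c = j then ?p j else ?a c)"
    proof (rule add_mono)
      show "2 * (?p c * ?m c) \<le> 2 * ?t" using m by linarith
      have "?p c * (?a c * ?a c) \<le> ?p c * 1"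
        using sum1 nn by (intro mult_left_mono mult_le_one) auto
      moreover have "?p c * (?a c * ?a c) \<le> 1 * (1 * ?a c)"
        using sum1 nn pop_le_one by (intro mult_mono) auto
      ultimately show "?p c * (?a c * ?a c) \<le> (if c = j then ?p j else ?a c)" by auto
    qed
    finally show ?thesis .
  qed
  then have "(\<Sum>c\<in>chunks k. ?p c * (?m c + ?a c)\<^sup>2)
      \<le> (\<Sum>c\<in>chunks k. 2 * ?t + (if c = j then ?p j else ?a c))"
    by (rule sum_mono)
  also have "\<dots> = 2 * ?K * ?t + (\<Sum>c\<in>chunks k. if c = j then ?p j else ?a c)"
    by (simp add: sum.distrib)
  also have "(\<Sum>c\<in>chunks k. if c = j then ?p j else ?a c) = ?p j + (\<Sum>c\<in>chunks k - {j}. ?a c)"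
    using j(1) by (subst sum.remove[of _ j]) (auto intro!: sum.cong)
  also have "(\<Sum>c\<in>chunks k - {j}. ?a c) \<le> ?p j"
    by (rule pop_ge_sum_only_lacking[OF assms(1) j(1)])
  also have "2 * ?K * ?t \<le> ?K ^ 3 * ?t"
  proof (rule mult_right_mono[OF _ t])
    have "2 \<le> ?K * ?K" using mult_mono[of 2 ?K 1 ?K] K by simp
    then have "?K * 2 \<le> ?K * (?K * ?K)" using K by (intro mult_left_mono) auto
    then show "2 * ?K \<le> ?K ^ 3" by (simp add: power3_eq_cube)
  qed
  finally show ?thesis using j(2) by simp
qed

lemma exp_one_bounds: "2 \<le> exp (1::real)" "exp (1::real) \<le> 3"
  using exp_ge_add_one_self[of "1::real"] exp_le by auto

lemma empty_download_cost_le: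
  assumes "2 \<le> k" "8 \<le> S k x"
  shows "(exp 1 - 1) * (real (S k x) * exp (- real (S0 x)))
      * (real (S0 x) * (\<Sum>c\<in>chunks k. pdl k x {} c))
    \<le> 27 * exp 1 * real k ^ 3 * dl_rate k x + 24 * real k"
proof -
  let ?s = "real (S k x)" and ?n = "real (S0 x)" and ?T = "dl_rate k x" and ?K = "real k"
  let ?P = "\<Sum>c\<in>chunks k. pdl k x {} c" and ?e = "empties k x"
  have s: "0 < ?s" using assms(2) by simp
  have K: "2 \<le> ?K" using assms(1) by simp
  have T: "0 \<le> ?T" by (rule dl_rate_nonneg)
  have P: "0 \<le> ?P" by (simp add: sum_nonneg pdl_nonneg)
  have K3: "1 \<le> ?K ^ 3" using K by simp
  have big: "54 * (?K ^ 3 * ?T) \<le> 27 * exp 1 * ?K ^ 3 * ?T"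
    using mult_right_mono[OF exp_one_bounds(1), of "27 * (?K ^ 3 * ?T)"] T by (simp add: mult_ac)
  have ne: "?n * exp (- ?n) \<le> 1 / 2" by (rule mult_exp_minus_le)
  show ?thesis
  proof (cases "?e \<le> 1 / 8")
    case False
    then have "?s \<le> 8 * ?n" using s by (simp add: empties_def field_simps)
    then have "?s * exp (- ?n) \<le> 8 * ?n * exp (- ?n)" by (intro mult_right_mono) auto
    then have "?s * exp (- ?n) \<le> 4" using ne unfolding mult.assoc by linarith
    then have "(exp 1 - 1) * (?s * exp (- ?n)) \<le> 2 * 4"
      using exp_one_bounds s by (intro mult_mono) auto
    then have "(exp 1 - 1) * (?s * exp (- ?n)) * (?n * ?P) \<le> 8 * ?T"
      using dl_rate_ge_empties[OF assms(1), of x] P T by (intro mult_mono) auto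
    also have "\<dots> \<le> 54 * (?K ^ 3 * ?T)"
      using mult_right_mono[OF K3 T] T by linarith
    also note big
    finally show ?thesis using K by linarith
  next
    case True
    have "?P \<le> (\<Sum>c\<in>chunks k. 3 * (pop k x c * (mid_lacking k x c + only_lacking k x c)\<^sup>2) + 6 * ?e)"
    proof (rule sum_mono)
      fix c assume c: "c \<in> chunks k"
      let ?p = "pop k x c" and ?b = "mid_lacking k x c + only_lacking k x c"
      have pb: "1 - ?p = ?e + ?b" using one_minus_pop[OF assms(1) c, of x] by simp
      have b: "0 \<le> ?b" by (simp add: mid_lacking_nonneg only_lacking_nonneg)
      have p: "0 \<le> ?p" "?p \<le> 1" by (rule pop_nonneg pop_le_one)+
      have "(1 - ?p)\<^sup>2 = ?b\<^sup>2 + ?e * ((?e + ?b) + ?b)"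
        unfolding pb by (simp add: power2_eq_square algebra_simps)
      also have "\<dots> \<le> ?b\<^sup>2 + ?e * 2"
        using pb p b empties_nonneg[of k x] by (intro add_mono mult_left_mono) auto
      finally have "?p * (1 - ?p)\<^sup>2 \<le> ?p * (?b\<^sup>2 + ?e * 2)"
        using p by (intro mult_left_mono) auto
      moreover have "?p * (?e * 2) \<le> 1 * (?e * 2)"
        using p empties_nonneg[of k x] by (intro mult_right_mono) auto
      ultimately show "pdl k x {} c \<le> 3 * (?p * ?b\<^sup>2) + 6 * ?e"
        using pdl_empty_le[OF c, of x] by (simp add: algebra_simps)
    qed
    also have "\<dots> = 3 * (\<Sum>c\<in>chunks k. pop k x c * (mid_lacking k x c + only_lacking k x c)\<^sup>2) + 6 * ?K * ?e"
      by (simp add: sum.distrib sum_distrib_left)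
    also have "\<dots> \<le> 21 * ?K ^ 3 * (?T / ?s) + 6 * ?K * (?n / ?s)"
      using sum_pop_lacking_le[OF assms(1) True assms(2)] by (simp add: empties_def)
    finally have "?s * ?P \<le> ?s * (21 * ?K ^ 3 * (?T / ?s) + 6 * ?K * (?n / ?s))"
      using s by (intro mult_left_mono) auto
    then have sP: "?s * ?P \<le> 21 * ?K ^ 3 * ?T + 6 * ?K * ?n"
      using s by (simp add: algebra_simps)
    have n2: "?n ^ 2 * exp (- ?n) \<le> 1"
      using power_mult_exp_minus_le[of ?n 2] by simp
    have "(?n * exp (- ?n)) * (?s * ?P) \<le> (?n * exp (- ?n)) * (21 * ?K ^ 3 * ?T + 6 * ?K * ?n)"
      using sP by (intro mult_left_mono) auto
    also have "\<dots> = (?n * exp (- ?n)) * (21 * ?K ^ 3 * ?T) + 6 * ?K * (?n ^ 2 * exp (- ?n))"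
      by (simp add: power2_eq_square algebra_simps)
    also have "\<dots> \<le> 1 / 2 * (21 * ?K ^ 3 * ?T) + 6 * ?K * 1"
      using ne n2 T K by (intro add_mono mult_left_mono mult_right_mono) auto
    finally have "(?n * exp (- ?n)) * (?s * ?P) \<le> 21 / 2 * (?K ^ 3 * ?T) + 6 * ?K" by simp
    then have "(exp 1 - 1) * ((?n * exp (- ?n)) * (?s * ?P)) \<le> 2 * (21 / 2 * (?K ^ 3 * ?T) + 6 * ?K)"
      using exp_one_bounds s P by (intro mult_mono) auto
    also have "\<dots> \<le> 54 * (?K ^ 3 * ?T) + 24 * ?K"
      using T K mult_nonneg_nonneg[of "?K ^ 3" ?T] by simp
    also note big
    finally show ?thesis by (simp add: mult_ac)
  qed
qed

lemma dl_rate_ge_cube: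
  assumes "2 \<le> k" "c \<in> chunks k"
  shows "3 / 8 * real (Si k x c) * (1 - pop k x c) ^ 3 \<le> dl_rate k x"
proof -
  let ?p = "pop k x c" and ?e = "empties k x" and ?m = "mid_lacking k x c"
    and ?a = "only_lacking k x c" and ?s = "real (S k x)"
  have s: "0 < ?s" using S_pos[of k x] by simp
  note nn = pop_nonneg[of k x c] pop_le_one[of k x c] empties_nonneg[of k x]
    mid_lacking_nonneg[of k x c] only_lacking_nonneg[of k x c]
  have pb: "1 - ?p = ?e + ?m + ?a" by (rule one_minus_pop[OF assms])
  have sq: "0 \<le> (1 - ?p)\<^sup>2" "(1 - ?p)\<^sup>2 \<le> 1"
    using nn by (auto intro!: power_le_one)
  have "3 / 8 * (1 - ?p) ^ 3 \<le> 3 * ?e * (1 - ?p)\<^sup>2 + ?m + 3 * ?a ^ 3"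
  proof (cases "(1 - ?p) / 2 \<le> ?a")
    case True
    have "((1 - ?p) / 2) ^ 3 \<le> ?a ^ 3" using True nn by (intro power_mono) auto
    then have "3 / 8 * (1 - ?p) ^ 3 \<le> 3 * ?a ^ 3" by (simp add: power_divide)
    moreover have "0 \<le> 3 * ?e * (1 - ?p)\<^sup>2" using nn by simp
    ultimately show ?thesis using nn by linarith
  next
    case False
    then have "(1 - ?p) / 2 \<le> ?e + ?m" using pb by simp
    then have "(1 - ?p) / 2 * (1 - ?p)\<^sup>2 \<le> (?e + ?m) * (1 - ?p)\<^sup>2"
      using sq by (intro mult_right_mono) auto
    moreover have "?m * (1 - ?p)\<^sup>2 \<le> ?m" using mult_left_mono[OF sq(2) nn(4)] by simp
    moreover have "(1 - ?p) / 2 * (1 - ?p)\<^sup>2 = 1 / 2 * (1 - ?p) ^ 3"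
      by (simp add: power2_eq_square power3_eq_cube)
    moreover have "0 \<le> ?e * (1 - ?p)\<^sup>2" "0 \<le> ?a ^ 3" "0 \<le> (1 - ?p) ^ 3" using nn by simp_all
    ultimately show ?thesis unfolding distrib_right mult.assoc by linarith
  qed
  then have "?p * (3 / 8 * (1 - ?p) ^ 3) \<le> ?p * (3 * ?e * (1 - ?p)\<^sup>2 + ?m + 3 * ?a ^ 3)"
    using nn by (intro mult_left_mono)
  also have "\<dots> \<le> dl_rate k x / ?s" by (rule dl_rate_ge[OF assms])
  finally have "3 / 8 * (?p * ?s) * (1 - ?p) ^ 3 \<le> dl_rate k x"
    using s by (simp add: pos_le_divide_eq mult_ac)
  moreover have "?p * ?s = real (Si k x c)" using s by (simp add: pop_def)
  ultimately show ?thesis by (simp only:)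
qed

lemma exists_rare_chunk:
  assumes "2 \<le> k"
  shows "\<exists>c\<in>chunks k. (1 - 1 / real (S k x)) / real k \<le> 1 - pop k x c"
proof (rule exists_ge_average)
  have "(\<Sum>c\<in>chunks k. 1 - pop k x c) = real k * empties k x
      + (\<Sum>c\<in>chunks k. mid_lacking k x c) + (\<Sum>c\<in>chunks k. only_lacking k x c)"
    using one_minus_pop[OF assms, of _ x] by (simp add: sum.distrib)
  moreover have "1 * empties k x \<le> real k * empties k x"
    using assms by (intro mult_right_mono empties_nonneg) auto
  ultimately have "1 - 1 / real (S k x) \<le> (\<Sum>c\<in>chunks k. 1 - pop k x c)"
    using sum_fractions_ge[OF assms, of x] by linarith
  then show "real (card (chunks k)) * ((1 - 1 / real (S k x)) / real k) \<le> (\<Sum>c\<in>chunks k. 1 - pop k x c)"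
    using assms by simp
qed (use chunks_nonempty[OF assms] in auto)

subsection \<open>Negative drift\<close>

lemma drift_Lyap_simple_le:
  assumes "2 \<le> k" "0 \<le> lam" "36 \<le> S k x" "C = 108 * exp 1 * real k ^ 3"
  shows "drift k lam (Lyap k C) x
    \<le> C * lam * real k + lam * (real k + 1) + 25 * real k
      - lam / 2 * (real (S k x) * exp (- real (S0 x))) - 3 / 4 * (C * dl_rate k x)
      - 1 / 2 * (\<Sum>c\<in>chunks k. real (S0 x) * pdl k x {} c * (real (S k x) * exp (- real (Si k x c))))"
proof -
  let ?s = "real (S k x)" and ?K = "real k"
  let ?se = "?s * exp (- real (S0 x))"
  let ?G = "\<Sum>c\<in>chunks k. real (S0 x) * pdl k x {} c * (?s * exp (- real (Si k x c)))"
  have s: "36 \<le> ?s" using assms(3) by simp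
  have e: "1 / 2 \<le> 1 - exp (-1 :: real)"
    using exp_one_bounds by (simp add: exp_minus field_simps)
  have "3 * (exp 1 - 1) * (real (Si k x i) ^ 3 * exp (- real (Si k x i))) / ?s \<le> 1" for i
  proof -
    have "real (Si k x i) ^ 3 * exp (- real (Si k x i)) \<le> 6"
      using power_mult_exp_minus_le[of "real (Si k x i)" 3] by (simp add: power3_eq_cube)
    then have "3 * (exp 1 - 1) * (real (Si k x i) ^ 3 * exp (- real (Si k x i))) \<le> 6 * 6"
      using exp_one_bounds by (intro mult_mono) auto
    then show ?thesis using s by (simp add: field_simps)
  qed
  then have 1: "(\<Sum>i\<in>chunks k. 3 * (exp 1 - 1) * (real (Si k x i) ^ 3 * exp (- real (Si k x i))) / ?s) \<le> ?K"
    using sum_bounded_above[of "chunks k" _ "1::real"] by simp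
  have 2: "1 / 2 * ?G \<le> (1 - exp (-1)) * ?G"
    by (intro mult_right_mono e sum_nonneg mult_nonneg_nonneg pdl_nonneg) auto
  have "1 / 2 * (lam * ?se) \<le> (1 - exp (-1)) * (lam * ?se)"
    using assms(2) by (intro mult_right_mono e mult_nonneg_nonneg) auto
  then have 3: "lam * (C * ?K + ?K + 1 - (1 - exp (-1)) * ?se)
      \<le> C * lam * ?K + lam * (?K + 1) - lam / 2 * ?se"
    by (simp add: algebra_simps)
  have 4: "(exp 1 - 1) * ?se * (real (S0 x) * (\<Sum>c\<in>chunks k. pdl k x {} c))
      \<le> 1 / 4 * (C * dl_rate k x) + 24 * ?K"
    using empty_download_cost_le[of k x] assms by (simp add: mult_ac)
  show ?thesis
    using drift_Lyap_le[OF assms(1,2), of C x] 1 2 3 4 by linarith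
qed

theorem theorem3:
  fixes k :: nat and lam :: real
  assumes "2 \<le> k" and "1 / (3 * real k) \<le> lam"
  shows "let C = 108 * exp 1 * real k ^ 3 in
    \<exists>\<epsilon>>0. \<forall>x. valid_state k x \<longrightarrow>
      real (S k x) > 4 * C * real k * exp (3 * C * lam * real k ^ 2 * exp (6 * lam * real k ^ 4)) \<longrightarrow>
      drift k lam (Lyap k C) x < - \<epsilon>"
proof -
  define C where "C = 108 * exp 1 * real k ^ 3"
  define K where "K = real k"
  define Z where "Z = 6 * lam * K ^ 4"
  define n0 where "n0 = 3 * C * lam * K ^ 2 * exp Z"
  define b where "b = C * lam * K"
  have K: "2 \<le> K" using assms(1) by (simp add: K_def)
  have lamK: "1 / 3 \<le> lam * K" using assms(2) K by (simp add: K_def field_simps)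
  have lam: "0 < lam" using assms(2) K by (intro less_le_trans[OF _ assms(2)]) (simp add: K_def)
  have K3: "4 * K \<le> K ^ 3"
    using mult_mono[of 2 K 2 K] mult_left_mono[of 4 "K * K" K] K by (simp add: power3_eq_cube)
  have C216: "216 * K ^ 3 \<le> C"
    using mult_right_mono[OF exp_one_bounds(1), of "108 * K ^ 3"] K by (simp add: C_def K_def mult_ac)
  have C: "1728 \<le> C" using C216 K3 K by linarith
  have b_K: "288 * K \<le> b"
  proof -
    have "C * (1 / 3) \<le> b" using mult_left_mono[OF lamK, of C] C by (simp add: b_def mult_ac)
    then show ?thesis using C216 K3 by linarith
  qed
  have b_pos: "0 < b" using b_K K by linarith
  have b_lam: "lam * (K + 1) \<le> b / 100"
  proof -
    have "200 * (lam * K) \<le> C * (lam * K)" using C lamK by (intro mult_right_mono) auto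
    moreover have "lam * 1 \<le> lam * K" using lam K by (intro mult_left_mono) auto
    ultimately show ?thesis by (simp add: b_def distrib_left mult_ac)
  qed
  have Z: "0 \<le> Z" using lam K by (simp add: Z_def)
  have "drift k lam (Lyap k C) x < - (b / 10)"
    if big: "4 * C * K * exp n0 < real (S k x)" for x
  proof -
    let ?s = "real (S k x)" and ?n = "real (S0 x)" and ?T = "dl_rate k x"
    let ?G = "\<Sum>c\<in>chunks k. ?n * pdl k x {} c * (?s * exp (- real (Si k x c)))"
    have "1 \<le> exp n0" using C lam K by (simp add: n0_def)
    then have "4 * C * K * 1 \<le> 4 * C * K * exp n0" using C K by (intro mult_left_mono) auto
    moreover have "100 * 2 \<le> 4 * C * K" using C K by (intro mult_mono) auto
    ultimately have s: "100 \<le> ?s" using big by linarith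
    have T: "0 \<le> C * ?T" using C dl_rate_nonneg[of k x] by simp
    have G_term: "0 \<le> ?n * pdl k x {} c * (?s * exp (- real (Si k x c)))" for c
      by (intro mult_nonneg_nonneg pdl_nonneg) auto
    have G: "0 \<le> ?G" by (intro sum_nonneg G_term)
    have A: "0 \<le> lam / 2 * (?s * exp (- ?n))" using lam by simp
    have main: "drift k lam (Lyap k C) x \<le> b + b / 100 + 25 / 288 * b
        - lam / 2 * (?s * exp (- ?n)) - 3 / 4 * (C * ?T) - 1 / 2 * ?G"
    proof -
      have "36 \<le> S k x" using s by linarith
      from drift_Lyap_simple_le[of k lam x C, OF assms(1) less_imp_le[OF lam] this C_def]
      show ?thesis
        using b_K b_lam unfolding K_def[symmetric] b_def[symmetric] by linarith
    qed
    show ?thesis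
    proof (cases "?n \<le> n0")
      case True
      have "4 * C * K * 1 \<le> 4 * C * K * (exp n0 * exp (- ?n))"
        using True C K by (intro mult_left_mono) (simp_all add: exp_add[symmetric])
      also have "\<dots> \<le> ?s * exp (- ?n)"
        using mult_right_mono[OF less_imp_le[OF big], of "exp (- ?n)"] by (simp add: mult_ac)
      finally have "lam / 2 * (4 * C * K * 1) \<le> lam / 2 * (?s * exp (- ?n))"
        using lam by (intro mult_left_mono) auto
      then have "2 * b \<le> lam / 2 * (?s * exp (- ?n))" by (simp add: b_def mult_ac)
      then show ?thesis using main T G b_pos by linarith
    next
      case False
      obtain c where c: "c \<in> chunks k" "(1 - 1 / ?s) / K \<le> 1 - pop k x c"
        using exists_rare_chunk[OF assms(1), of x] unfolding K_def by blast
      have "99 / 100 \<le> 1 - 1 / ?s" using s by (simp add: field_simps)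
      then have "99 / 100 / K \<le> (1 - 1 / ?s) / K" using K by (intro divide_right_mono) auto
      then have pb: "99 / 100 / K \<le> 1 - pop k x c" using c(2) by linarith
      let ?r = "real (Si k x c)"
      show ?thesis
      proof (cases "?r \<le> Z")
        case True
        have pb2: "(99 / 100 / K)\<^sup>2 \<le> (1 - pop k x c)\<^sup>2" using pb K by (intro power_mono) auto
        have r1: "1 \<le> ?r" using Si_pos[of k x c] by simp
        have Zr: "Z * exp (- Z) \<le> ?r * exp (- ?r)" by (rule mult_exp_minus_antimono[OF r1 True])
        have "n0 * (3 / K * ((99 / 100 / K)\<^sup>2 * (Z * exp (- Z))))
            \<le> ?n * (3 / K * ((1 - pop k x c)\<^sup>2 * (?r * exp (- ?r))))"
          using False K Z by (intro mult_mono[OF _ mult_left_mono[OF mult_mono[OF pb2 Zr]]]) auto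
        also have "\<dots> = ?n * (3 * pop k x c * (1 - pop k x c)\<^sup>2 / real k) * (?s * exp (- ?r))"
          using s by (simp add: K_def pop_def)
        also have "\<dots> \<le> ?n * pdl k x {} c * (?s * exp (- ?r))"
          by (intro mult_right_mono mult_left_mono pdl_empty_ge c(1)) auto
        also have "\<dots> \<le> ?G"
          using c(1) by (intro member_le_sum G_term) auto
        finally have "n0 * (3 / K * ((99 / 100 / K)\<^sup>2 * (Z * exp (- Z)))) \<le> ?G" .
        moreover have "n0 * (3 / K * ((99 / 100 / K)\<^sup>2 * (Z * exp (- Z))))
            = 264627 / 5000 * (b * (lam * K) * K)"
        proof -
          have "exp Z * exp (- Z) = 1" by (simp add: exp_add[symmetric])
          moreover have "n0 * (3 / K * ((99 / 100 / K)\<^sup>2 * (Z * exp (- Z))))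
              = 264627 / 5000 * (b * (lam * K) * K) * (exp Z * exp (- Z))"
            using K by (simp add: n0_def Z_def b_def power2_eq_square power4_eq_xxxx field_simps)
          ultimately show ?thesis by simp
        qed
        moreover have "b * (1 / 3) * 2 \<le> b * (lam * K) * K"
          using b_pos lamK K by (intro mult_mono) auto
        ultimately have "30 * b \<le> ?G" using b_pos by linarith
        then show ?thesis using main T A b_pos by linarith
      next
        case False
        have "(99 / 100 / K) ^ 3 \<le> (1 - pop k x c) ^ 3" using pb K by (intro power_mono) auto
        then have "3 / 8 * Z * (99 / 100 / K) ^ 3 \<le> 3 / 8 * ?r * (1 - pop k x c) ^ 3"
          using False K Z by (intro mult_mono) auto
        also have "\<dots> \<le> ?T" by (rule dl_rate_ge_cube[OF assms(1) c(1)])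
        finally have "C * (3 / 8 * Z * (99 / 100 / K) ^ 3) \<le> C * ?T"
          using C by (intro mult_left_mono) auto
        moreover have "C * (3 / 8 * Z * (99 / 100 / K) ^ 3) = 8732691 / 4000000 * b"
          using K by (simp add: Z_def b_def power3_eq_cube power4_eq_xxxx field_simps)
        ultimately have "2 * b \<le> C * ?T" using b_pos by linarith
        then show ?thesis using main A G b_pos by linarith
      qed
    qed
  qed
  then show ?thesis
    unfolding Let_def C_def[symmetric] n0_def Z_def K_def using b_pos by (intro exI[of _ "b / 10"]) auto
qed

end
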